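(* Let $(\mathfrak g,[\cdot,\cdot]_{\mathfrak g})$ be a finite-dimensional real Lie algebra with a Sasakian structure $(\bar\xi,\bar\alpha,\bar\Phi)$. Let $\theta\in\wedge^2\mathfrak g^*$ be a $2$-cocycle, let $\mathfrak g_\theta=\mathfrak g\oplus\langle z\rangle$ be the corresponding central extension, let $D\in\operatorname{Der}(\mathfrak g_\theta)$, and let $\mathfrak g(\theta,D)=\langle D\rangle\ltimes\mathfrak g_\theta$ be the double extension. Let $\alpha=\bar\alpha+z^*\in\mathfrak g(\theta,D)^*$. Assume that $\alpha(D(z))\neq 0$, that $\alpha$ is a contact form on $\mathfrak g(\theta,D)$, and that its Reeb vector has the form $\xi=u+a\,\bar\xi+b\,z$ with $u\in\operatorname{Ker}(\bar\alpha)\subset\mathfrak g$ and $a,b\in\mathbb R$, $a+b=1$. Let $w=c\,\bar\xi+d\,z\in\operatorname{Ker}(\alpha)$ be non-zero (so $c+d=0$, $c\neq0$), so that $\mathfrak g(\theta,D)=\operatorname{Ker}(\bar\alpha)\oplus\langle w,D\rangle\oplus\langle\xi\rangle$, where $\operatorname{Ker}(\bar\alpha)$ is the kernel of $\bar\alpha$ in $\mathfrak g$. Define the linear map $\Phi:\mathfrak g(\theta,D)\to\mathfrak g(\theta,D)$ by $$\Phi(x)=\bar\Phi(x)\ \ (x\in\operatorname{Ker}(\bar\alpha)),\qquad \Phi(w)=D,\qquad \Phi(D)=-w,\qquad \Phi(\xi)=0 .$$ Then $(\xi,\alpha,\Phi)$ is a Sasakian structure on $\mathfrak g(\theta,D)$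 if and only if all of the following hold: 1. $\theta(\bar\Phi x,y)+\theta(x,\bar\Phi y)=0$ for all $x,y\in\operatorname{Ker}(\bar\alpha)$; 2. $u$ and $\bar\xi$ belong to $\operatorname{Rad}(\theta)=\{x\in\mathfrak g\mid\theta(x,y)=0\ \forall y\in\mathfrak g\}$; 3. $D\circ\bar\Phi=\Phi\circ D$ on $\operatorname{Ker}(\bar\alpha)$; 4. $\operatorname{ad}_{\mathfrak g}(u)=-\bar\Phi\circ\operatorname{ad}_{\mathfrak g}(u)\circ\bar\Phi$; 5. $c\,[\bar\xi,u]+\Phi(D(\xi))=0$.
   Context: For $\alpha$ in the dual of a Lie algebra, $d\alpha(x,y)=-\alpha([x,y])$. Central extension: for a $2$-cocycle $\theta\in\wedge^2\mathfrak g^*$ (trivial coefficients), $\mathfrak g_\theta=\mathfrak g\oplus\langle z\rangle$ with $z\notin\mathfrak g$, $[x,y]_\theta=[x,y]_{\mathfrak g}+\theta(x,y)z$ for $x,y\in\mathfrak g$, and $z$ central. Double extension: for $D\in\operatorname{Der}(\mathfrak g_\theta)$, $\mathfrak g(\theta,D)=\langle D\rangle\oplus\mathfrak g_\theta$, with the bracket of $\mathfrak g_\theta$ on $\mathfrak g_\theta$ and $[D,v]=D(v)$ for $v\in\mathfrak g_\theta$. The functional $\bar\alpha\in\mathfrak g^*$ is extended to $\mathfrak g(\theta,D)$ by $\bar\alpha(z)=\bar\alpha(D)=0$, and $z^*$ is the functional with $z^*(z)=1$ and $z^*(\mathfrak g)=0$, $z^*(D)=0$. Contact Lie algebra: a Lie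 algebra of dimension $2n+1$ with $\alpha\in\mathfrak g^*$ such that $\alpha\wedge(d\alpha)^n\neq0$; its Reeb vector is the unique $\xi$ with $\alpha(\xi)=1$ and $\alpha([\xi,y])=0$ for all $y$. Sasakian structure (metric not part of the data): a triple $(\xi,\alpha,\Phi)$ on a real Lie algebra where $\alpha$ is a contact form with Reeb vector $\xi$, and $\Phi$ is a linear endomorphism such that $\Phi^2=-\operatorname{Id}+\alpha\otimes\xi$ (i.e. $\Phi^2x=-x+\alpha(x)\xi$) and $N_\Phi=-d\alpha\otimes\xi$, where $N_\Phi(x,y)=\Phi^2[x,y]+[\Phi x,\Phi y]-\Phi[x,\Phi y]-\Phi[\Phi x,y]$. *)

theory Defs
  imports "HOL-Analysis.Analysis" "HOL-Combinatorics.Permutations"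
begin

definition lie_algebra :: "('a::real_vector \<Rightarrow> 'a \<Rightarrow> 'a) \<Rightarrow> bool" where
  "lie_algebra br \<longleftrightarrow>
     bilinear br \<and> (\<forall>x. br x x = 0) \<and>
     (\<forall>x y z. br x (br y z) + br y (br z x) + br z (br x y) = 0)"

definition derivation :: "('a::real_vector \<Rightarrow> 'a \<Rightarrow> 'a) \<Rightarrow> ('a \<Rightarrow> 'a) \<Rightarrow> bool" where
  "derivation br D \<longleftrightarrow> linear D \<and> (\<forall>x y. D (br x y) = br (D x) y + br x (D y))"

definition cocycle2 ::
  "('a::real_vector \<Rightarrow> 'a \<Rightarrow> 'a) \<Rightarrow> ('a \<Rightarrow> 'a \<Rightarrow> real) \<Rightarrow> bool" where
  "cocycle2 br \<theta> \<longleftrightarrow>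
     bilinear \<theta> \<and> (\<forall>x. \<theta> x x = 0) \<and>
     (\<forall>x y z. \<theta> (br x y) z + \<theta> (br y z) x + \<theta> (br z x) y = 0)"

definition Rad :: "('a \<Rightarrow> 'a \<Rightarrow> real) \<Rightarrow> 'a set" where
  "Rad \<theta> = {x. \<forall>y. \<theta> x y = 0}"

text \<open>A \<open>k\<close>-form is encoded as a function of a sequence \<open>v\<close> of vectors that only looks at
  \<open>v 0, \<dots>, v (k - 1)\<close>; in \<open>wedge p q \<omega> \<eta>\<close> the arguments \<open>p\<close> and \<open>q\<close> are
  the degrees of \<open>\<omega>\<close> and \<open>\<eta>\<close>.\<close>

type_synonym 'a form = "(nat \<Rightarrow> 'a) \<Rightarrow> real"

definition wedge :: "nat \<Rightarrow> nat \<Rightarrow> 'a form \<Rightarrow> 'a form \<Rightarrow> 'a form" where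
  "wedge p q \<omega> \<eta> = (\<lambda>v.
     (\<Sum>\<sigma> | \<sigma> permutes {..<p + q}.
        of_int (sign \<sigma>) * \<omega> (\<lambda>i. v (\<sigma> i)) * \<eta> (\<lambda>i. v (\<sigma> (p + i))))
     / (fact p * fact q))"

primrec wedge_power :: "nat \<Rightarrow> 'a form \<Rightarrow> nat \<Rightarrow> 'a form" where
  "wedge_power k \<omega> 0 = (\<lambda>v. 1)"
| "wedge_power k \<omega> (Suc n) = wedge k (k * n) \<omega> (wedge_power k \<omega> n)"

definition one_form :: "('a \<Rightarrow> real) \<Rightarrow> 'a form" where
  "one_form \<alpha> = (\<lambda>v. \<alpha> (v 0))"

definition two_form :: "('a \<Rightarrow> 'a \<Rightarrow> real) \<Rightarrow> 'a form" where
  "two_form \<beta> = (\<lambda>v. \<beta> (v 0) (v 1))"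

definition ext_d :: "('a \<Rightarrow> 'a \<Rightarrow> 'a) \<Rightarrow> ('a \<Rightarrow> real) \<Rightarrow> 'a \<Rightarrow> 'a \<Rightarrow> real" where
  "ext_d br \<alpha> x y = - \<alpha> (br x y)"

text \<open>The library's \<open>dim\<close> is \<open>0\<close> for infinite-dimensional spaces, so an odd value of
  \<open>dim UNIV\<close> includes finite-dimensionality.\<close>

definition contact_form :: "('a::real_vector \<Rightarrow> 'a \<Rightarrow> 'a) \<Rightarrow> ('a \<Rightarrow> real) \<Rightarrow> bool" where
  "contact_form br \<alpha> \<longleftrightarrow> linear \<alpha> \<and>
     (\<exists>n. dim (UNIV :: 'a set) = 2 * n + 1 \<and>
          wedge 1 (2 * n) (one_form \<alpha>) (wedge_power 2 (two_form (ext_d br \<alpha>)) n) \<noteq> (\<lambda>v. 0))"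

definition reeb_vector :: "('a::real_vector \<Rightarrow> 'a \<Rightarrow> 'a) \<Rightarrow> ('a \<Rightarrow> real) \<Rightarrow> 'a \<Rightarrow> bool" where
  "reeb_vector br \<alpha> \<xi> \<longleftrightarrow> \<alpha> \<xi> = 1 \<and> (\<forall>y. \<alpha> (br \<xi> y) = 0)"

definition nijenhuis ::
  "('a::real_vector \<Rightarrow> 'a \<Rightarrow> 'a) \<Rightarrow> ('a \<Rightarrow> 'a) \<Rightarrow> 'a \<Rightarrow> 'a \<Rightarrow> 'a" where
  "nijenhuis br \<Phi> x y =
     \<Phi> (\<Phi> (br x y)) + br (\<Phi> x) (\<Phi> y) - \<Phi> (br x (\<Phi> y)) - \<Phi> (br (\<Phi> x) y)"

definition sasakian ::
  "('a::real_vector \<Rightarrow> 'a \<Rightarrow> 'a) \<Rightarrow> 'a \<Rightarrow> ('a \<Rightarrow> real) \<Rightarrow> ('a \<Rightarrow> 'a) \<Rightarrow> bool" where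
  "sasakian br \<xi> \<alpha> \<Phi> \<longleftrightarrow>
     lie_algebra br \<and> contact_form br \<alpha> \<and> reeb_vector br \<alpha> \<xi> \<and> linear \<Phi> \<and>
     (\<forall>x. \<Phi> (\<Phi> x) = - x + \<alpha> x *\<^sub>R \<xi>) \<and>
     (\<forall>x y. nijenhuis br \<Phi> x y = - ext_d br \<alpha> x y *\<^sub>R \<xi>)"

text \<open>The pair \<open>(x, s)\<close> stands for \<open>x + s z\<close> in the central extension, and \<open>(r, v)\<close> for
  \<open>r D + v\<close> in the double extension.\<close>

definition central_ext ::
  "('a::real_vector \<Rightarrow> 'a \<Rightarrow> 'a) \<Rightarrow> ('a \<Rightarrow> 'a \<Rightarrow> real) \<Rightarrow> 'a \<times> real \<Rightarrow> 'a \<times> real \<Rightarrow> 'a \<times> real" where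
  "central_ext br \<theta> v w = (br (fst v) (fst w), \<theta> (fst v) (fst w))"

definition double_ext ::
  "('a::real_vector \<Rightarrow> 'a \<Rightarrow> 'a) \<Rightarrow> ('a \<Rightarrow> 'a \<Rightarrow> real) \<Rightarrow> ('a \<times> real \<Rightarrow> 'a \<times> real) \<Rightarrow>
   real \<times> 'a \<times> real \<Rightarrow> real \<times> 'a \<times> real \<Rightarrow> real \<times> 'a \<times> real" where
  "double_ext br \<theta> D p q =
     (0, central_ext br \<theta> (snd p) (snd q) + fst p *\<^sub>R D (snd q) - fst q *\<^sub>R D (snd p))"

definition of_g :: "'a \<Rightarrow> 'a \<times> real" where
  "of_g x = (x, 0)"

definition vec_z :: "'a::real_vector \<times> real" where
  "vec_z = (0, 1)"

definition of_ext :: "'a::real_vector \<times> real \<Rightarrow> real \<times> 'a \<times> real" where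
  "of_ext v = (0, v)"

definition vec_D :: "real \<times> 'a::real_vector \<times> real" where
  "vec_D = (1, 0)"

definition extend_functional :: "('a::real_vector \<Rightarrow> real) \<Rightarrow> real \<times> 'a \<times> real \<Rightarrow> real" where
  "extend_functional \<alpha> p = \<alpha> (fst (snd p))"

definition z_dual :: "real \<times> 'a::real_vector \<times> real \<Rightarrow> real" where
  "z_dual p = snd (snd p)"

lemma bilinearD:
  assumes "bilinear f"
  shows "f (x + y) z = f x z + f y z" "f x (y + z) = f x y + f x z"
    "f (r *\<^sub>R x) y = r *\<^sub>R f x y" "f x (r *\<^sub>R y) = r *\<^sub>R f x y"
  using assms by (auto simp: bilinear_def linear_iff)

lemma bilinear_alternating_skew:
  assumes "bilinear f" "\<And>x. f x x = 0"
  shows "f x y = - f y x"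
proof -
  have "f (x + y) (x + y) = 0" by (rule assms(2))
  then have "f x y + f y x = 0"
    using assms(2)[of x] assms(2)[of y] by (simp add: bilinearD[OF assms(1)] add.commute)
  then show ?thesis by (metis eq_neg_iff_add_eq_0)
qed

lemma lie_algebra_central_ext:
  assumes L: "lie_algebra br" and C: "cocycle2 br \<theta>"
  shows "lie_algebra (central_ext br \<theta>)"
proof -
  have b: "bilinear br" and t: "bilinear \<theta>"
    and tx: "\<And>x. \<theta> x x = 0" and brx: "\<And>x. br x x = 0"
    using L C by (auto simp: lie_algebra_def cocycle2_def)
  have "\<theta> x (br y z) + \<theta> y (br z x) + \<theta> z (br x y) = 0" for x y z
    using C bilinear_alternating_skew[OF t tx, of x "br y z"]
      bilinear_alternating_skew[OF t tx, of y "br z x"]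
      bilinear_alternating_skew[OF t tx, of z "br x y"]
    unfolding cocycle2_def by (smt (verit))
  moreover have "bilinear (central_ext br \<theta>)"
    by (auto simp: bilinear_def linear_iff central_ext_def bilinearD[OF b] bilinearD[OF t])
  ultimately show ?thesis
    using L tx unfolding lie_algebra_def by (auto simp: central_ext_def zero_prod_def)
qed

lemma lie_algebra_double_ext:
  assumes L: "lie_algebra br" and C: "cocycle2 br \<theta>" and D: "derivation (central_ext br \<theta>) D"
  shows "lie_algebra (double_ext br \<theta> D)"
proof -
  let ?c = "central_ext br \<theta>"
  have c: "lie_algebra ?c" by (rule lie_algebra_central_ext[OF L C])
  have b: "bilinear ?c" and cx: "\<And>x. ?c x x = 0"
    and J: "\<And>x y z. ?c x (?c y z) + ?c y (?c z x) + ?c z (?c x y) = 0"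
    using c by (auto simp: lie_algebra_def)
  have sk: "?c x y = - ?c y x" for x y by (rule bilinear_alternating_skew[OF b cx])
  have lD: "linear D" and dD: "\<And>x y. D (?c x y) = ?c (D x) y + ?c x (D y)"
    using D by (auto simp: derivation_def)
  note Ds = linear_add[OF lD] linear_scale[OF lD] linear_diff[OF lD]
  have minus: "?c x (y - z) = ?c x y - ?c x z" for x y z
    using bilinear_rsub[OF b] .
  have "bilinear (double_ext br \<theta> D)"
    by (auto simp: bilinear_def linear_iff double_ext_def bilinearD[OF b] Ds algebra_simps)
  moreover have "double_ext br \<theta> D x (double_ext br \<theta> D y z) +
      double_ext br \<theta> D y (double_ext br \<theta> D z x) +
      double_ext br \<theta> D z (double_ext br \<theta> D x y) = 0" for x y z
  proof -
    obtain r v s w t u where [simp]: "x = (r, v)" "y = (s, w)" "z = (t, u)"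
      by (metis surj_pair)
    have mm: "?c x (- y) = - ?c x y" for x y
      using bilinear_rneg[OF b] .
    have "?c v (?c w u) + ?c w (?c u v) + ?c u (?c v w) = 0"
      using J[of v w u] by simp
    then show ?thesis
      by (simp add: double_ext_def bilinearD[OF b] minus Ds dD sk[of "D _"]
          zero_prod_def[symmetric] algebra_simps mm sk[of w v] sk[of u v] sk[of u w])
  qed
  ultimately show ?thesis
    unfolding lie_algebra_def by (auto simp: double_ext_def cx zero_prod_def)
qed

end

theory Submission
  imports Defs
begin

text \<open>Let \<open>H = Ker(alpha0)\<close>. Since \<open>\<Phi>\<^sup>2 = - Id + \<alpha> \<otimes> \<xi>\<close>, the condition on the Nijenhuis tensor is equivalent
  to the vanishing of \<open>M(p, q) = [\<Phi>p, \<Phi>q] - [p, q] - \<Phi>([p, \<Phi>q] + [\<Phi>p, q])\<close>, which has to be tested on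
  \<open>H\<close>, \<open>w\<close>, \<open>D\<close> and \<open>\<xi>\<close>. The \<open>D\<close>-component of \<open>M(\<xi>, x)\<close> for \<open>x \<in> H\<close> forces
  \<open>alpha0 [u, y] = 0\<close> for all \<open>y\<close>, so \<open>u = 0\<close> because \<open>alpha0\<close> is a contact form; on the other
  side condition 2 also forces \<open>u = 0\<close>, by the Reeb equation. Once \<open>u = 0\<close>, the hypothesis
  \<open>\<alpha>(D z) \<noteq> 0\<close> gives \<open>a \<noteq> 0\<close>, hence \<open>xi0 \<in> Rad \<theta>\<close>; then \<open>M\<close> vanishes on \<open>H \<times> H\<close> iff
  condition 1 holds, on \<open>H \<times> {D}\<close> iff condition 3 holds, on \<open>(D, \<xi>)\<close> iff \<open>D \<xi> = 0\<close>, which is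
  condition 5, and the other pairs give nothing new.\<close>

section \<open>Multilinear forms, wedge products and nondegeneracy of contact forms\<close>

definition multilinear_form :: "nat \<Rightarrow> 'a::real_vector form \<Rightarrow> bool" where
  "multilinear_form p \<omega> \<longleftrightarrow>
     (\<forall>v. \<forall>k<p. linear (\<lambda>x. \<omega> (v(k := x)))) \<and> (\<forall>v x. \<forall>k\<ge>p. \<omega> (v(k := x)) = \<omega> v)"

lemma multilinear_formD:
  assumes "multilinear_form p \<omega>"
  shows "k < p \<Longrightarrow> linear (\<lambda>x. \<omega> (v(k := x)))"
    and "p \<le> k \<Longrightarrow> \<omega> (v(k := x)) = \<omega> v"
  using assms by (auto simp: multilinear_form_def)

lemma permutes_fun_upd:
  assumes "\<sigma> permutes S"
  shows "(\<lambda>i. (v(k := x)) (\<sigma> i)) = (\<lambda>i. v (\<sigma> i))(inv \<sigma> k := x)"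
  using permutes_inverses[OF assms] by (auto simp: fun_eq_iff)

lemma shift_fun_upd:
  "(\<lambda>i. (v(j := x)) (p + i)) = (if p \<le> j then (\<lambda>i. v (p + i))(j - p := x) else (\<lambda>i. v (p + i)))"
  for p j :: nat
  by (auto simp: fun_eq_iff)

text \<open>In a permuted term the \<open>k\<close>-th vector sits at position
  \<open>inv \<sigma> k\<close> only. Below \<open>p\<close> it is an argument of
  \<open>\<omega>\<close> alone; from \<open>p\<close> on, \<open>\<omega>\<close> ignores it and
  \<open>\<eta>\<close> receives it in slot \<open>j - p\<close>. So exactly one factor sees a
  changed vector.\<close>

lemma wedge_term_fun_upd:
  fixes p k :: nat
  assumes \<omega>: "multilinear_form p \<omega>" and \<sigma>: "\<sigma> permutes S"
  defines "j \<equiv> inv \<sigma> k"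
  shows "\<omega> (\<lambda>i. (v(k := x)) (\<sigma> i)) * \<eta> (\<lambda>i. (v(k := x)) (\<sigma> (p + i))) =
    (if j < p then \<omega> ((\<lambda>i. v (\<sigma> i))(j := x)) * \<eta> (\<lambda>i. v (\<sigma> (p + i)))
     else \<omega> (\<lambda>i. v (\<sigma> i)) * \<eta> ((\<lambda>i. v (\<sigma> (p + i)))(j - p := x)))"
proof -
  have "(\<lambda>i. (v(k := x)) (\<sigma> (p + i))) = (\<lambda>i. ((\<lambda>i. v (\<sigma> i))(j := x)) (p + i))"
    using permutes_fun_upd[OF \<sigma>, of v k x] unfolding j_def by (auto simp only: fun_eq_iff)
  then show ?thesis
    by (simp only: permutes_fun_upd[OF \<sigma>] shift_fun_upd j_def[symmetric])
       (use multilinear_formD(2)[OF \<omega>] in auto)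
qed

lemma multilinear_form_wedge:
  assumes \<omega>: "multilinear_form p \<omega>" and \<eta>: "multilinear_form q \<eta>"
  shows "multilinear_form (p + q) (wedge p q \<omega> \<eta>)"
  unfolding multilinear_form_def
proof (intro conjI allI impI)
  fix v :: "nat \<Rightarrow> 'a" and k assume k: "k < p + q"
  have lin: "linear (\<lambda>x. of_int (sign \<sigma>) * \<omega> (\<lambda>i. (v(k := x)) (\<sigma> i)) *
      \<eta> (\<lambda>i. (v(k := x)) (\<sigma> (p + i))))" if "\<sigma> permutes {..<p + q}" for \<sigma>
  proof -
    have j: "inv \<sigma> k < p + q"
      using permutes_in_image[OF permutes_inv[OF that], of k] k by auto
    show ?thesis
      unfolding mult.assoc wedge_term_fun_upd[OF \<omega> that]
      using multilinear_formD(1)[OF \<omega>, of "inv \<sigma> k" "\<lambda>i. v (\<sigma> i)"]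
        multilinear_formD(1)[OF \<eta>, of "inv \<sigma> k - p" "\<lambda>i. v (\<sigma> (p + i))"] j
      by (auto simp: linear_iff algebra_simps)
  qed
  have "linear (\<lambda>x. \<Sum>\<sigma> | \<sigma> permutes {..<p + q}. of_int (sign \<sigma>) *
      \<omega> (\<lambda>i. (v(k := x)) (\<sigma> i)) * \<eta> (\<lambda>i. (v(k := x)) (\<sigma> (p + i))))"
    by (rule linear_compose_sum) (use lin in blast)
  then show "linear (\<lambda>x. wedge p q \<omega> \<eta> (v(k := x)))"
    unfolding linear_iff wedge_def by (simp del: fun_upd_apply add: add_divide_distrib)
next
  fix v :: "nat \<Rightarrow> 'a" and x k assume k: "p + q \<le> k"
  have *: "\<omega> (\<lambda>i. (v(k := x)) (\<sigma> i)) * \<eta> (\<lambda>i. (v(k := x)) (\<sigma> (p + i))) =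
      \<omega> (\<lambda>i. v (\<sigma> i)) * \<eta> (\<lambda>i. v (\<sigma> (p + i)))" if "\<sigma> permutes {..<p + q}" for \<sigma>
  proof -
    have "inv \<sigma> k = k"
      using permutes_not_in[OF permutes_inv[OF that], of k] k by auto
    then show ?thesis
      unfolding wedge_term_fun_upd[OF \<omega> that]
      using k multilinear_formD(2)[OF \<eta>, of "k - p"] by auto
  qed
  show "wedge p q \<omega> \<eta> (v(k := x)) = wedge p q \<omega> \<eta> v"
    unfolding wedge_def mult.assoc
    by (rule arg_cong[where f = "\<lambda>s. s / _"]) (rule sum.cong, simp_all add: * del: fun_upd_apply)
qed

lemma multilinear_form_one_form: "linear \<alpha> \<Longrightarrow> multilinear_form (Suc 0) (one_form \<alpha>)"
  by (auto simp: multilinear_form_def one_form_def)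

lemma multilinear_form_two_form: "bilinear \<beta> \<Longrightarrow> multilinear_form 2 (two_form \<beta>)"
  by (auto simp: multilinear_form_def two_form_def bilinear_def less_2_cases_iff)

lemma multilinear_form_wedge_power:
  "multilinear_form k \<omega> \<Longrightarrow> multilinear_form (k * n) (wedge_power k \<omega> n)"
proof (induction n)
  case 0
  then show ?case by (simp add: multilinear_form_def)
next
  case (Suc n)
  then show ?case using multilinear_form_wedge[OF Suc.prems Suc.IH] by simp
qed

text \<open>For an alternating form this says that the interior product with \<open>u\<close>
  vanishes; all slots are tested so that no alternation has to be assumed. In degree 0 it is
  vacuous, which starts the induction on wedge powers.\<close>

definition annihilates :: "'a \<Rightarrow> nat \<Rightarrow> 'a form \<Rightarrow> bool" where
  "annihilates u p \<omega> \<longleftrightarrow> (\<forall>v. \<forall>k<p. \<omega> (v(k := u)) = 0)"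

text \<open>In each term of the sum, one of the two factors receives \<open>u\<close>.\<close>

lemma annihilates_wedge:
  assumes \<omega>: "multilinear_form p \<omega>" "annihilates u p \<omega>" and \<eta>: "annihilates u q \<eta>"
  shows "annihilates u (p + q) (wedge p q \<omega> \<eta>)"
  unfolding annihilates_def
proof (intro allI impI)
  fix v :: "nat \<Rightarrow> 'a" and k assume k: "k < p + q"
  have *: "\<omega> (\<lambda>i. (v(k := u)) (\<sigma> i)) * \<eta> (\<lambda>i. (v(k := u)) (\<sigma> (p + i))) = 0"
    if "\<sigma> permutes {..<p + q}" for \<sigma>
  proof -
    have "inv \<sigma> k < p + q"
      using permutes_in_image[OF permutes_inv[OF that], of k] k by auto
    then show ?thesis
      unfolding wedge_term_fun_upd[OF \<omega>(1) that]
      using \<omega>(2) \<eta> by (auto simp: annihilates_def)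
  qed
  show "wedge p q \<omega> \<eta> (v(k := u)) = 0"
    unfolding wedge_def mult.assoc by (simp add: * del: fun_upd_apply)
qed

lemma annihilates_wedge_power:
  "multilinear_form k \<omega> \<Longrightarrow> annihilates u k \<omega> \<Longrightarrow> annihilates u (k * n) (wedge_power k \<omega> n)"
proof (induction n)
  case 0
  then show ?case by (simp add: annihilates_def)
next
  case (Suc n)
  then show ?case using annihilates_wedge[OF Suc.prems Suc.IH] by simp
qed

text \<open>Reindexing the sum by the transposition of \<open>i\<close> and \<open>j\<close> changes its sign.\<close>

lemma wedge_eq_0_if_repeated:
  assumes ij: "i < p + q" "j < p + q" "i \<noteq> j" and v: "v i = v j"
  shows "wedge p q \<omega> \<eta> v = 0"
proof -
  let ?P = "{\<sigma>. \<sigma> permutes {..<p + q}}"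
  let ?\<tau> = "Transposition.transpose i j"
  let ?f = "\<lambda>\<sigma>. of_int (sign \<sigma>) * \<omega> (\<lambda>i. v (\<sigma> i)) * \<eta> (\<lambda>i. v (\<sigma> (p + i)))"
  have \<tau>: "?\<tau> permutes {..<p + q}" using ij by (simp add: permutes_swap_id)
  have v\<tau>: "v (?\<tau> k) = v k" for k using v by (auto simp: Transposition.transpose_def)
  have sgn: "sign (?\<tau> \<circ> \<sigma>) = - sign \<sigma>" if "\<sigma> permutes {..<p + q}" for \<sigma>
  proof -
    have "permutation \<sigma>" "permutation ?\<tau>"
      using that \<tau> by (auto intro: permutes_imp_permutation[OF finite_lessThan])
    then show ?thesis using ij(3) by (simp add: sign_compose sign_swap_id)
  qed
  have "sum ?f ?P = (\<Sum>\<sigma>\<in>?P. ?f (?\<tau> \<circ> \<sigma>))"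
    by (rule setum_permutations_compose_left[OF \<tau>])
  also have "\<dots> = - sum ?f ?P"
    unfolding sum_negf[symmetric] by (rule sum.cong) (auto simp: sgn v\<tau>)
  finally have "sum ?f ?P = 0" by simp
  then show ?thesis by (simp add: wedge_def)
qed

text \<open>A vector in \<open>Ker(\<alpha>)\<close> and in the radical of the exterior derivative
  annihilates both factors of the top form \<open>F\<close>, hence \<open>F\<close>. But if
  \<open>F v\<close> is non-zero, then \<open>v\<close> is a basis, and a non-zero \<open>u\<close>
  could be exchanged for some \<open>v k\<close> without making \<open>F\<close> vanish.\<close>

lemma contact_form_nondegenerate:
  fixes br :: "'a::real_vector \<Rightarrow> 'a \<Rightarrow> 'a"
  assumes contact: "contact_form br \<alpha>" and br: "bilinear br"
    and u: "\<alpha> u = 0" "\<And>y. \<alpha> (br u y) = 0" "\<And>y. \<alpha> (br y u) = 0"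
  shows "u = 0"
proof (rule ccontr)
  assume "u \<noteq> 0"
  obtain n where dim: "dim (UNIV :: 'a set) = 2 * n + 1"
    and nz: "wedge 1 (2 * n) (one_form \<alpha>) (wedge_power 2 (two_form (ext_d br \<alpha>)) n) \<noteq> (\<lambda>v. 0)"
    and lin: "linear \<alpha>"
    using contact by (auto simp: contact_form_def)
  define m where "m = 1 + 2 * n"
  define F where "F = wedge 1 (2 * n) (one_form \<alpha>) (wedge_power 2 (two_form (ext_d br \<alpha>)) n)"
  have "bilinear (ext_d br \<alpha>)"
    by (auto simp: bilinear_def linear_iff ext_d_def bilinearD[OF br] linear_add[OF lin]
        linear_scale[OF lin])
  then have two: "multilinear_form 2 (two_form (ext_d br \<alpha>))"
    by (rule multilinear_form_two_form)
  have ann2: "annihilates u 2 (two_form (ext_d br \<alpha>))"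
    using u by (auto simp: annihilates_def two_form_def ext_d_def less_2_cases_iff)
  have one: "multilinear_form 1 (one_form \<alpha>)"
    using multilinear_form_one_form[OF lin] by simp
  have ann1: "annihilates u 1 (one_form \<alpha>)"
    using u by (auto simp: annihilates_def one_form_def)
  have F: "multilinear_form m F"
    unfolding F_def m_def by (intro multilinear_form_wedge one multilinear_form_wedge_power two)
  have Fu: "F (v(k := u)) = 0" if "k < m" for v k
    using annihilates_wedge[OF one ann1 annihilates_wedge_power[OF two ann2, of n]] that
    unfolding F_def m_def annihilates_def by blast
  have alt: "F v = 0" if "i < m" "j < m" "i \<noteq> j" "v i = v j" for v i j
    using that unfolding F_def m_def by (rule wedge_eq_0_if_repeated)
  obtain v where v: "F v \<noteq> 0" using nz by (auto simp: F_def)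
  have zero: "F (v(k := x)) = 0" if x: "x \<in> span (v ` ({..<m} - {k}))" and k: "k < m" for x k
  proof (rule linear_eq_0_on_span[OF multilinear_formD(1)[OF F k] _ x])
    fix y assume "y \<in> v ` ({..<m} - {k})"
    then obtain j where "j < m" "j \<noteq> k" "y = v j" by auto
    then show "F (v(k := y)) = 0" using k by (intro alt[of k j]) auto
  qed
  have notin: "v k \<notin> span (v ` ({..<m} - {k}))" if "k < m" for k
    using zero[OF _ that, of "v k"] v by auto
  have inj: "inj_on v {..<m}"
    using alt v by (metis inj_onI lessThan_iff)
  have indep: "independent (v ` {..<m})"
    unfolding dependent_def
  proof
    assume "\<exists>a\<in>v ` {..<m}. a \<in> span (v ` {..<m} - {a})"
    then obtain k where k: "k < m" "v k \<in> span (v ` {..<m} - {v k})" by auto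
    have "v ` {..<m} - {v k} = v ` ({..<m} - {k})"
      using inj k(1) by (auto simp: inj_on_def)
    then show False using notin k by simp
  qed
  obtain B where B: "v ` {..<m} \<subseteq> B" "independent B" "(UNIV :: 'a set) \<subseteq> span B"
    by (rule maximal_independent_subset_extend[OF subset_UNIV indep])
  have cB: "card B = m"
    using dim_eq_card[of B UNIV, OF _ B(2)] B(3) dim by (simp add: m_def top.extremum_unique)
  \<comment> \<open>An infinite set has cardinality 0, whereas \<open>m\<close> is positive.\<close>
  then have "finite B" by (metis card.infinite m_def add_is_0 one_neq_zero)
  then have "v ` {..<m} = B"
    using B(1) cB card_image[OF inj] by (intro card_subset_eq) auto
  then have um: "u \<in> span (v ` {..<m})" using B(3) by auto
  \<comment> \<open>Minimality makes \<open>v k\<close> with \<open>k = l - 1\<close> the last basis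
    vector that occurs in \<open>u\<close>, so its coefficient \<open>r\<close> is non-zero and
    \<open>v k\<close> can be exchanged for \<open>u\<close>.\<close>
  define l where "l = (LEAST l. u \<in> span (v ` {..<l}))"
  have l: "u \<in> span (v ` {..<l})" "\<And>i. i < l \<Longrightarrow> u \<notin> span (v ` {..<i})" "l \<le> m"
    unfolding l_def using um by (auto intro: LeastI Least_le dest: not_less_Least)
  obtain k where k: "l = Suc k" using l(1) \<open>u \<noteq> 0\<close> by (cases l) auto
  then have km: "k < m" using l(3) by simp
  obtain r where r: "u - r *\<^sub>R v k \<in> span (v ` {..<k})"
    using l(1) span_breakdown_eq[of u "v k" "v ` {..<k}"] by (auto simp: k lessThan_Suc)
  have "r \<noteq> 0" using r l(2)[of k] k by auto
  have "v ` {..<k} \<subseteq> v ` ({..<m} - {k})" using km by auto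
  \<comment> \<open>Expanding this by linearity gives \<open>F (v(k := u)) = r * F v\<close>, where
    the left side is 0 and the right side is not.\<close>
  then have "F (v(k := u - r *\<^sub>R v k)) = 0"
    using r km by (intro zero) (auto dest: span_mono)
  moreover have "F (v(k := u - r *\<^sub>R v k)) = F (v(k := u)) - r * F (v(k := v k))"
    using linear_diff[OF multilinear_formD(1)[OF F km, of v]]
      linear_scale[OF multilinear_formD(1)[OF F km, of v]] by simp
  ultimately show False using Fu[OF km] v \<open>r \<noteq> 0\<close> by simp
qed

section \<open>Almost contact structures and the normality tensor\<close>

text \<open>Computing \<open>\<Phi> (\<Phi> (\<Phi> x))\<close> in two ways gives \<open>eq\<close>.
  At \<open>\<xi>\<close> it makes \<open>\<Phi> \<xi>\<close> a multiple of \<open>\<xi>\<close>,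
  and \<open>\<Phi> (\<Phi> \<xi>) = 0\<close> forces this multiple to vanish.\<close>

lemma almost_contact_structure:
  assumes "linear \<Phi>" "linear \<alpha>" and sq: "\<And>x. \<Phi> (\<Phi> x) = - x + \<alpha> x *\<^sub>R \<xi>" and \<xi>: "\<alpha> \<xi> = 1"
  shows "\<Phi> \<xi> = 0" and "\<alpha> (\<Phi> x) = 0"
proof -
  note lin = linear_add[OF assms(1)] linear_neg[OF assms(1)] linear_scale[OF assms(1)]
  have eq: "\<alpha> (\<Phi> x) *\<^sub>R \<xi> = \<alpha> x *\<^sub>R \<Phi> \<xi>" for x
    using sq[of "\<Phi> x"] arg_cong[OF sq[of x], of \<Phi>] unfolding lin
    by (simp add: algebra_simps)
  have "\<Phi> (\<Phi> \<xi>) = 0" by (simp add: sq[of \<xi>] \<xi>)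
  then have "\<Phi> (\<alpha> (\<Phi> \<xi>) *\<^sub>R \<xi>) = 0" by (simp add: eq \<xi> lin)
  then have "\<alpha> (\<Phi> \<xi>) *\<^sub>R \<Phi> \<xi> = 0" by (simp only: lin)
  then show "\<Phi> \<xi> = 0"
    using eq[of \<xi>] \<xi> by auto
  then have "\<alpha> (\<Phi> x) *\<^sub>R \<xi> = 0" using eq[of x] by simp
  then show "\<alpha> (\<Phi> x) = 0" using \<xi> linear_0[OF assms(2)] by auto
qed

text \<open>This is the tensor \<open>M\<close>: the Nijenhuis tensor plus the exterior derivative
  of \<alpha> times \<xi>, after the square of \<Phi> has been substituted. Neither \<alpha> nor
  \<xi> occurs in it any more.\<close>

definition normality ::
  "('a::real_vector \<Rightarrow> 'a \<Rightarrow> 'a) \<Rightarrow> ('a \<Rightarrow> 'a) \<Rightarrow> 'a \<Rightarrow> 'a \<Rightarrow> 'a" where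
  "normality br \<Phi> x y = br (\<Phi> x) (\<Phi> y) - br x y - \<Phi> (br x (\<Phi> y) + br (\<Phi> x) y)"

lemma nijenhuis_eq_iff_normality:
  assumes "linear \<Phi>" "\<And>x. \<Phi> (\<Phi> x) = - x + \<alpha> x *\<^sub>R \<xi>"
  shows "nijenhuis br \<Phi> x y = - ext_d br \<alpha> x y *\<^sub>R \<xi> \<longleftrightarrow> normality br \<Phi> x y = 0"
proof -
  have "nijenhuis br \<Phi> x y = \<alpha> (br x y) *\<^sub>R \<xi> + normality br \<Phi> x y"
    by (simp add: nijenhuis_def normality_def assms(2) linear_add[OF assms(1)])
  then show ?thesis by (simp add: ext_d_def)
qed

lemma bilinear_normality:
  assumes "bilinear br" "linear \<Phi>"
  shows "bilinear (normality br \<Phi>)"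
  by (auto simp: bilinear_def linear_iff normality_def bilinearD[OF assms(1)]
      linear_add[OF assms(2)] linear_scale[OF assms(2)] algebra_simps)

lemma normality_self:
  assumes "lie_algebra br" "linear \<Phi>"
  shows "normality br \<Phi> x x = 0"
proof -
  have "br x (\<Phi> x) = - br (\<Phi> x) x"
    using assms(1) by (intro bilinear_alternating_skew) (auto simp: lie_algebra_def)
  then show ?thesis
    using assms by (simp add: normality_def lie_algebra_def linear_0)
qed

section \<open>Sasakian structures on the double extension\<close>

theorem theorem3p1:
  fixes br :: "'a::real_vector \<Rightarrow> 'a \<Rightarrow> 'a"
    and \<theta> :: "'a \<Rightarrow> 'a \<Rightarrow> real"
    and D :: "'a \<times> real \<Rightarrow> 'a \<times> real"
    and xi0 u :: 'a and alpha0 :: "'a \<Rightarrow> real" and Phi0 :: "'a \<Rightarrow> 'a"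
    and \<alpha> :: "real \<times> 'a \<times> real \<Rightarrow> real"
    and \<Phi> :: "real \<times> 'a \<times> real \<Rightarrow> real \<times> 'a \<times> real"
    and \<xi> w :: "'a \<times> real"
    and a b c d :: real
  assumes fin_dim: "\<exists>B. finite B \<and> span B = (UNIV :: 'a set)"
    and lie: "lie_algebra br"
    and sasakian: "sasakian br xi0 alpha0 Phi0"
    and cocycle: "cocycle2 br \<theta>"
    and der: "derivation (central_ext br \<theta>) D"
    and alpha: "\<alpha> = (\<lambda>p. extend_functional alpha0 p + z_dual p)"
    and alpha_Dz: "\<alpha> (of_ext (D vec_z)) \<noteq> 0"
    and contact: "contact_form (double_ext br \<theta> D) \<alpha>"
    and reeb: "reeb_vector (double_ext br \<theta> D) \<alpha> (of_ext \<xi>)"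
    and xi: "\<xi> = of_g u + a *\<^sub>R of_g xi0 + b *\<^sub>R vec_z" "alpha0 u = 0" "a + b = 1"
    and w: "w = c *\<^sub>R of_g xi0 + d *\<^sub>R vec_z" "\<alpha> (of_ext w) = 0" "w \<noteq> 0"
    and Phi_linear: "linear \<Phi>"
    and Phi_ker: "\<And>x. alpha0 x = 0 \<Longrightarrow> \<Phi> (of_ext (of_g x)) = of_ext (of_g (Phi0 x))"
    and Phi_w: "\<Phi> (of_ext w) = vec_D"
    and Phi_D: "\<Phi> vec_D = - of_ext w"
    and Phi_xi: "\<Phi> (of_ext \<xi>) = 0"
  shows "sasakian (double_ext br \<theta> D) (of_ext \<xi>) \<alpha> \<Phi> \<longleftrightarrow>
      (\<forall>x y. alpha0 x = 0 \<longrightarrow> alpha0 y = 0 \<longrightarrow> \<theta> (Phi0 x) y + \<theta> x (Phi0 y) = 0) \<and>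
      (u \<in> Rad \<theta> \<and> xi0 \<in> Rad \<theta>) \<and>
      (\<forall>x. alpha0 x = 0 \<longrightarrow> of_ext (D (of_g (Phi0 x))) = \<Phi> (of_ext (D (of_g x)))) \<and>
      br u = (\<lambda>x. - Phi0 (br u (Phi0 x))) \<and>
      c *\<^sub>R double_ext br \<theta> D (of_ext (of_g xi0)) (of_ext (of_g u)) + \<Phi> (of_ext (D \<xi>)) = 0"
proof -
  let ?E = "double_ext br \<theta> D"
  define h :: "'a \<Rightarrow> real \<times> 'a \<times> real" where "h x = (0, x, 0)" for x
  define X where "X = of_ext \<xi>"
  define W where "W = of_ext w"
  define Z :: "real \<times> 'a \<times> real" where "Z = vec_D"
  let ?M = "normality ?E \<Phi>"
  have lieE: "lie_algebra ?E" by (rule lie_algebra_double_ext[OF lie cocycle der])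
  have b: "bilinear br" and t: "bilinear \<theta>" and bE: "bilinear ?E" and lD: "linear D"
    and lP: "linear Phi0" and la: "linear alpha0"
    using lie cocycle lieE der sasakian
    by (auto simp: lie_algebra_def cocycle2_def derivation_def sasakian_def contact_form_def)
  have br_self: "br x x = 0" and th_self: "\<theta> x x = 0" and E_self: "?E p p = 0" for x p
    using lie cocycle lieE unfolding lie_algebra_def cocycle2_def by blast+
  note sk = bilinear_alternating_skew[OF b br_self] bilinear_alternating_skew[OF t th_self]
  note lins = linear_add[OF la] linear_scale[OF la] linear_diff[OF la] linear_neg[OF la] linear_0[OF la]
    linear_add[OF lP] linear_scale[OF lP] linear_diff[OF lP] linear_neg[OF lP] linear_0[OF lP]
    linear_add[OF lD] linear_scale[OF lD] linear_diff[OF lD] linear_neg[OF lD] linear_0[OF lD]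
    linear_add[OF Phi_linear] linear_scale[OF Phi_linear] linear_diff[OF Phi_linear]
    linear_neg[OF Phi_linear] linear_0[OF Phi_linear]
    bilinearD[OF b] bilinearD[OF t] bilinearD[OF bE]
    bilinear_rsub[OF b] bilinear_lsub[OF b] bilinear_rsub[OF t] bilinear_lsub[OF t]
    bilinear_rneg[OF b] bilinear_lneg[OF b] bilinear_rzero[OF b] bilinear_lzero[OF b]
    bilinear_rneg[OF t] bilinear_lneg[OF t] bilinear_rzero[OF t] bilinear_lzero[OF t]
    bilinear_rneg[OF bE] bilinear_lneg[OF bE] bilinear_rzero[OF bE] bilinear_lzero[OF bE]
  have sq0: "Phi0 (Phi0 x) = - x + alpha0 x *\<^sub>R xi0" and reeb0: "alpha0 (br xi0 x) = 0"
    and a_xi0: "alpha0 xi0 = 1" and norm0: "normality br Phi0 x y = 0" for x y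
    using sasakian nijenhuis_eq_iff_normality[OF lP, of alpha0 xi0]
    by (auto simp: sasakian_def reeb_vector_def)
  have P_xi0: "Phi0 xi0 = 0" and a_P: "alpha0 (Phi0 x) = 0" for x
    using almost_contact_structure[OF lP la sq0 a_xi0] by auto
  \<comment> \<open>Applying \<open>alpha0\<close> to the normality of \<open>Phi0\<close> removes
    the term in the image of \<open>Phi0\<close>.\<close>
  have inv0: "alpha0 (br (Phi0 x) (Phi0 y)) = alpha0 (br x y)" for x y
    using arg_cong[OF norm0[of x y], of alpha0] by (simp add: normality_def lins a_P)
  have xi0_P: "br xi0 (Phi0 x) = Phi0 (br xi0 x)" for x
    using norm0[of xi0 "Phi0 x"] by (simp add: normality_def P_xi0 sq0[of x] lins br_self)
  have al: "\<alpha> (r, x, s) = alpha0 x + s" for r x s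
    by (simp add: alpha extend_functional_def z_dual_def)
  have l\<alpha>: "linear \<alpha>"
    by (auto simp: linear_iff al lins algebra_simps)
  have d: "d = - c" and c: "c \<noteq> 0"
    using w by (auto simp: of_ext_def of_g_def vec_z_def al lins a_xi0 zero_prod_def)
  have bb: "b = 1 - a" using xi(3) by simp
  have X: "X = (0, u + a *\<^sub>R xi0, 1 - a)" and W: "W = (0, c *\<^sub>R xi0, - c)" and Z: "Z = (1, 0, 0)"
    by (simp_all add: X_def W_def Z_def xi(1) w(1) d bb of_ext_def of_g_def vec_z_def vec_D_def
        zero_prod_def)
  have \<Phi>: "alpha0 x = 0 \<Longrightarrow> \<Phi> (h x) = h (Phi0 x)" "\<Phi> W = Z" "\<Phi> Z = - W" "\<Phi> X = 0" for x
    using Phi_ker Phi_w Phi_D Phi_xi by (simp_all add: h_def X_def W_def Z_def of_ext_def of_g_def)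
  have E_gg: "?E (0, x, r) (0, y, s) = (0, br x y, \<theta> x y)" for x y r s
    by (simp add: double_ext_def central_ext_def)
  have E_Dg: "?E Z (0, v) = (0, D v)" "?E (0, v) Z = - (0, D v)" for v
    by (simp_all add: double_ext_def central_ext_def Z lins zero_prod_def)
  have \<alpha>X: "\<alpha> X = 1" and \<alpha>E: "\<alpha> (?E X p) = 0" for p
    using reeb unfolding reeb_vector_def X_def by blast+
  \<comment> \<open>The Reeb equation tested on the original algebra; the contribution of
    \<open>a *\<^sub>R xi0\<close> to \<open>alpha0\<close> vanishes because \<open>xi0\<close> is a
    Reeb vector there.\<close>
  have reeb_g: "alpha0 (br u y) + \<theta> u y + a * \<theta> xi0 y = 0" for y
    using \<alpha>E[of "(0, y, 0)"] by (simp add: X E_gg al lins reeb0)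
  have nondeg: "u = 0" if "\<And>y. alpha0 (br u y) = 0"
  proof (rule contact_form_nondegenerate[OF _ b xi(2) that])
    show "contact_form br alpha0" using sasakian by (simp add: sasakian_def)
    show "alpha0 (br y u) = 0" for y using that[of y] sk(1)[of y u] by (simp add: lins)
  qed

  \<comment> \<open>Reduction to generators\<close>
  have gens: "f p = 0" if f: "linear f" "\<And>x. alpha0 x = 0 \<Longrightarrow> f (h x) = 0" "f W = 0" "f Z = 0" "f X = 0"
    for f :: "real \<times> 'a \<times> real \<Rightarrow> real \<times> 'a \<times> real" and p
  proof -
    obtain r x s where p: "p = (r, x, s)" by (metis surj_pair)
    \<comment> \<open>The coefficient of \<open>X\<close> must be
      \<open>\<alpha> p = alpha0 x + s\<close>, since \<alpha> kills the other summands;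
      \<open>k\<close> is then read off from the z-component.\<close>
    define x' where "x' = x - (alpha0 x + s) *\<^sub>R u - alpha0 x *\<^sub>R xi0"
    define k where "k = ((alpha0 x + s) * (1 - a) - s) / c"
    have "k * c = (alpha0 x + s) * (1 - a) - s" using c by (simp add: k_def)
    then have "p = h x' + k *\<^sub>R W + r *\<^sub>R Z + (alpha0 x + s) *\<^sub>R X"
      by (simp add: p h_def W Z X x'_def) (simp add: algebra_simps)
    moreover have "alpha0 x' = 0" by (simp add: x'_def lins a_xi0 xi(2))
    ultimately show ?thesis
      using f by (simp add: linear_add linear_scale)
  qed
  have sq: "\<Phi> (\<Phi> p) = - p + \<alpha> p *\<^sub>R X" for p
  proof -
    have "\<Phi> (\<Phi> p) + p - \<alpha> p *\<^sub>R X = 0"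
    proof (rule gens[where f = "\<lambda>p. \<Phi> (\<Phi> p) + p - \<alpha> p *\<^sub>R X"])
      show "linear (\<lambda>p. \<Phi> (\<Phi> p) + p - \<alpha> p *\<^sub>R X)"
        by (auto simp: linear_iff lins linear_add[OF l\<alpha>] linear_scale[OF l\<alpha>] algebra_simps)
      show "\<Phi> (\<Phi> (h x)) + h x - \<alpha> (h x) *\<^sub>R X = 0" if "alpha0 x = 0" for x
        using that by (simp add: \<Phi> a_P sq0) (simp add: h_def al zero_prod_def)
      show "\<Phi> (\<Phi> W) + W - \<alpha> W *\<^sub>R X = 0" "\<Phi> (\<Phi> Z) + Z - \<alpha> Z *\<^sub>R X = 0"
        by (simp_all add: \<Phi> lins) (simp_all add: W Z al lins a_xi0 zero_prod_def)
      show "\<Phi> (\<Phi> X) + X - \<alpha> X *\<^sub>R X = 0" by (simp add: \<Phi> lins \<alpha>X)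
    qed
    then show ?thesis by (simp add: algebra_simps)
  qed
  \<comment> \<open>All clauses but the Nijenhuis one are hypotheses or already established.\<close>
  have key: "sasakian ?E (of_ext \<xi>) \<alpha> \<Phi> \<longleftrightarrow> (\<forall>p q. ?M p q = 0)"
    using lieE contact reeb Phi_linear sq
    unfolding sasakian_def nijenhuis_eq_iff_normality[OF Phi_linear sq, unfolded X_def] X_def by blast
  have bM: "bilinear ?M" by (rule bilinear_normality[OF bE Phi_linear])
  have M_self: "?M p p = 0" for p by (rule normality_self[OF lieE Phi_linear])
  have M_skew: "?M p q = - ?M q p" for p q by (rule bilinear_alternating_skew[OF bM M_self])
  \<comment> \<open>Bilinearity and skewness leave one order of each pair of generators to test:
    first the second argument is freed for every kind of generator, then the first argument.\<close>
  have M_gens: "\<forall>p q. ?M p q = 0"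
    if M: "\<And>x y. alpha0 x = 0 \<Longrightarrow> alpha0 y = 0 \<Longrightarrow> ?M (h x) (h y) = 0"
      "\<And>x. alpha0 x = 0 \<Longrightarrow> ?M X (h x) = 0" "\<And>x. alpha0 x = 0 \<Longrightarrow> ?M (h x) Z = 0"
      "\<And>x. alpha0 x = 0 \<Longrightarrow> ?M (h x) W = 0" "?M Z X = 0" "?M W X = 0" "?M W Z = 0"
  proof (intro allI)
    fix p q
    have lin: "linear (?M p)" "linear (\<lambda>p. ?M p q)" for p q
      using bM unfolding bilinear_def by blast+
    have "?M (h x) q = 0" if "alpha0 x = 0" for x q
      by (rule gens[OF lin(1)]) (use that M M_skew[of "h x" X] in simp_all)
    moreover have "?M W q = 0" for q
      by (rule gens[OF lin(1)]) (use M M_skew[of W "h _"] in \<open>simp_all add: M_self\<close>)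
    moreover have "?M Z q = 0" for q
      by (rule gens[OF lin(1)]) (use M M_skew[of Z "h _"] M_skew[of Z W] in \<open>simp_all add: M_self\<close>)
    moreover have "?M X q = 0" for q
      by (rule gens[OF lin(1)]) (use M M_skew[of X W] M_skew[of X Z] in \<open>simp_all add: M_self\<close>)
    ultimately show "?M p q = 0"
      by (rule gens[OF lin(2)])
  qed
  \<comment> \<open>The values of \<theta> in the z-component are traded for
    \<open>alpha0 (br u y)\<close> through \<open>reeb_g\<close>.\<close>
  have Xh: "?E X (h y) = (0, br u y + a *\<^sub>R br xi0 y, - alpha0 (br u y))" for y
    using reeb_g[of y] by (simp add: X h_def E_gg lins)
  have u0: "u = 0" if M: "\<And>x. alpha0 x = 0 \<Longrightarrow> ?M X (h x) = 0"
  proof (rule nondeg)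
    fix y
    have fst_\<Phi>: "fst (\<Phi> (?E X (h x))) = alpha0 (br u x) / c" for x
    proof -
      let ?t = "alpha0 (br u x)"
      \<comment> \<open>The bracket is split along \<open>Ker(alpha0)\<close> and \<open>W\<close>;
        only the multiple of \<open>W\<close> acquires a D-component under \<Phi>.\<close>
      have "?E X (h x) = h (br u x + a *\<^sub>R br xi0 x - ?t *\<^sub>R xi0) + (?t / c) *\<^sub>R W"
        unfolding Xh using c by (simp add: h_def W)
      moreover have "alpha0 (br u x + a *\<^sub>R br xi0 x - ?t *\<^sub>R xi0) = 0"
        by (simp add: lins reeb0 a_xi0)
      ultimately show ?thesis by (simp add: lins \<Phi>) (simp add: h_def Z)
    qed
    have P: "alpha0 (br u (Phi0 x)) = 0" if "alpha0 x = 0" for x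
    proof -
      have "fst (?M X (h x)) = - fst (\<Phi> (?E X (h (Phi0 x))))"
        using that by (simp add: normality_def \<Phi> lins Xh)
      then show ?thesis using M[OF that] c by (simp add: fst_\<Phi>)
    qed
    have "alpha0 (br u xi0) = 0" using reeb0[of u] sk(1)[of u xi0] by (simp add: lins)
    \<comment> \<open>Up to a multiple of \<open>xi0\<close>, every vector is the image under
      \<open>Phi0\<close> of an element of \<open>Ker(alpha0)\<close>.\<close>
    moreover have "y = - Phi0 (Phi0 y) + alpha0 y *\<^sub>R xi0" by (simp add: sq0)
    ultimately show "alpha0 (br u y) = 0"
      using P[OF a_P, of y] by (metis lins(1,2,4) bilinearD(2,4)[OF b] bilinear_rneg[OF b]
          add_0 mult_zero_right neg_equal_0_iff_equal real_scaleR_def)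
  qed

  \<comment> \<open>Comparison with the five conditions\<close>
  show ?thesis
  proof (cases "u = 0")
    \<comment> \<open>Here both sides of the equivalence fail.\<close>
    case False
    have "u = 0" if "u \<in> Rad \<theta> \<and> xi0 \<in> Rad \<theta>"
    proof (rule nondeg)
      show "alpha0 (br u y) = 0" for y using reeb_g[of y] that by (simp add: Rad_def)
    qed
    then have "\<not> (u \<in> Rad \<theta> \<and> xi0 \<in> Rad \<theta>)" using False by blast
    moreover have "\<not> sasakian ?E (of_ext \<xi>) \<alpha> \<Phi>"
      using False key u0 by blast
    ultimately show ?thesis by blast
  next
    case True
    define K where "K x = of_ext (D (of_g x))" for x
    have X0: "X = (0, a *\<^sub>R xi0, 1 - a)" by (simp add: X True)
    have EDX: "?E Z X = of_ext (D \<xi>)" by (simp add: X_def of_ext_def E_Dg)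
    have \<alpha>DX: "\<alpha> (of_ext (D \<xi>)) = 0"
      using \<alpha>E[of Z] linear_neg[OF l\<alpha>] by (simp add: X_def E_Dg of_ext_def del: uminus_Pair)
    \<comment> \<open>For \<open>a = 0\<close> the Reeb vector would be z, and the Reeb equation
      against D would give \<open>\<alpha>(D z) = 0\<close>.\<close>
    have a: "a \<noteq> 0"
    proof
      assume "a = 0"
      then have "\<xi> = vec_z" using X0 by (simp add: X_def of_ext_def vec_z_def)
      then show False using \<alpha>DX alpha_Dz by simp
    qed
    have th: "\<theta> xi0 y = 0" "\<theta> y xi0 = 0" for y
      using reeb_g[of y] a sk(2)[of y xi0] by (simp_all add: True lins)
    \<comment> \<open>Through this value, z-components of brackets, hence values of \<theta>, turn
      into D-components under \<Phi>.\<close>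
    have \<Phi>z: "\<Phi> (0, 0, 1) = - (a / c) *\<^sub>R Z"
    proof -
      have "(0, 0, 1) = X - (a / c) *\<^sub>R W" using c by (simp add: X0 W)
      then show ?thesis by (simp only: lins \<Phi>) simp
    qed
    have \<Phi>_ker: "\<Phi> (0, x, s) = (- a * s / c, Phi0 x, 0)" if "alpha0 x = 0" for x s
    proof -
      have "(0, x, s) = h x + s *\<^sub>R (0, 0, 1)" by (simp add: h_def)
      then show ?thesis using that by (simp only: lins \<Phi> \<Phi>z) (simp add: h_def Z)
    qed
    have hW: "?E (h x) W = c *\<^sub>R h (br x xi0)" "alpha0 (br x xi0) = 0"
      "br (Phi0 x) xi0 = Phi0 (br x xi0)" for x
      using sk(1)[of _ xi0] by (simp_all add: h_def W E_gg lins th reeb0 xi0_P)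
    have hZ: "?E (h x) Z = - K x" for x
      by (simp add: h_def E_Dg K_def of_ext_def of_g_def)
    have WX: "?E W X = 0"
      by (simp add: W X0 E_gg lins br_self th_self zero_prod_def)
    have M_hh: "?M (h x) (h y) = (a * (\<theta> (Phi0 x) y + \<theta> x (Phi0 y)) / c, 0,
        \<theta> (Phi0 x) (Phi0 y) - \<theta> x y)" if xy: "alpha0 x = 0" "alpha0 y = 0" for x y
    proof -
      \<comment> \<open>The sum of the mixed brackets lies in \<open>Ker(alpha0)\<close>, so
        \<open>\<Phi>_ker\<close> applies to it. The middle component of the result then vanishes by
        the normality of \<open>Phi0\<close>.\<close>
      have "alpha0 (br x (Phi0 y) + br (Phi0 x) y) = 0"
        using inv0[of x "Phi0 y"] xy by (simp add: sq0 lins)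
      moreover have "br (Phi0 x) (Phi0 y) - br x y = Phi0 (br x (Phi0 y) + br (Phi0 x) y)"
        using norm0[of x y] by (simp add: normality_def)
      ultimately show ?thesis
        using xy by (simp add: normality_def \<Phi>) (simp add: h_def E_gg \<Phi>_ker algebra_simps add_divide_distrib diff_divide_distrib)
    qed
    have M_Xh: "?M X (h x) = 0" if "alpha0 x = 0" for x
    proof -
      have "?E X (h y) = h (a *\<^sub>R br xi0 y)" for y unfolding Xh by (simp add: True lins h_def)
      then show ?thesis
        using that by (simp add: normality_def \<Phi> lins reeb0)
          (simp add: h_def xi0_P sq0 reeb0 lins zero_prod_def)
    qed
    have hs: "h (- x) = - h x" for x by (simp add: h_def)
    have M_hZ: "?M (h x) Z = K x + \<Phi> (K (Phi0 x))" if "alpha0 x = 0" for x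
      using that by (simp add: normality_def \<Phi> lins hW hZ)
    have M_hW: "?M (h x) W = \<Phi> (K x) - K (Phi0 x)" if "alpha0 x = 0" for x
      using that by (simp add: normality_def \<Phi> lins hW hZ a_P sq0 hs)
    have M_ZX: "?M Z X = - of_ext (D \<xi>)" and M_WX: "?M W X = - \<Phi> (of_ext (D \<xi>))"
      by (simp_all add: normality_def \<Phi> lins WX EDX)
    have M_WZ: "?M W Z = 0"
      using bilinear_alternating_skew[OF bE E_self, of W Z]
      by (simp add: normality_def \<Phi> lins E_self)
    have \<theta>_iff: "(\<forall>x y. alpha0 x = 0 \<longrightarrow> alpha0 y = 0 \<longrightarrow> ?M (h x) (h y) = 0) \<longleftrightarrow>
        (\<forall>x y. alpha0 x = 0 \<longrightarrow> alpha0 y = 0 \<longrightarrow> \<theta> (Phi0 x) y + \<theta> x (Phi0 y) = 0)" (is "?L \<longleftrightarrow> ?R")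
    proof
      show ?R if ?L
        using that a c by (simp add: M_hh zero_prod_def)
      show ?L if R: ?R
      proof (intro allI impI)
        fix x y assume xy: "alpha0 x = 0" "alpha0 y = 0"
        have "\<theta> (Phi0 x) y + \<theta> x (Phi0 y) = 0" using R xy by blast
        \<comment> \<open>Condition 1 with \<open>Phi0 y\<close> in place of \<open>y\<close> takes
          care of the z-component, as \<open>Phi0\<close> squares to minus the identity on
          \<open>Ker(alpha0)\<close>.\<close>
        moreover have "\<theta> (Phi0 x) (Phi0 y) + \<theta> x (Phi0 (Phi0 y)) = 0" using R xy a_P by blast
        ultimately show "?M (h x) (h y) = 0"
          using xy by (simp add: M_hh sq0 lins zero_prod_def)
      qed
    qed
    have D_iff: "(\<forall>x. alpha0 x = 0 \<longrightarrow> ?M (h x) Z = 0 \<and> ?M (h x) W = 0) \<longleftrightarrow>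
        (\<forall>x. alpha0 x = 0 \<longrightarrow> K (Phi0 x) = \<Phi> (K x))" (is "?L \<longleftrightarrow> ?R")
    proof
      show ?R if ?L using that by (simp add: M_hW)
      show ?L if R: ?R
      proof (intro allI impI conjI)
        fix x assume x: "alpha0 x = 0"
        then show "?M (h x) W = 0" using R by (simp add: M_hW)
        \<comment> \<open>The pair with \<open>W\<close> is condition 3 at \<open>x\<close>; the
          pair with \<open>Z\<close> is condition 3 at \<open>Phi0 x\<close>.\<close>
        have "K (Phi0 (Phi0 x)) = \<Phi> (K (Phi0 x))" using R a_P by blast
        moreover have "K (Phi0 (Phi0 x)) = - K x"
          using x linear_neg[OF lD, of "(x, 0)"]
          by (simp add: K_def sq0 of_ext_def of_g_def)
        ultimately show "?M (h x) Z = 0" using x by (simp add: M_hZ flip: \<open>K _ = \<Phi> _\<close>)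
      qed
    qed
    \<comment> \<open>By the Reeb equation \<open>D \<xi>\<close> lies in
      \<open>Ker(\<alpha>)\<close>, where \<Phi> is injective.\<close>
    have X_iff: "of_ext (D \<xi>) = 0 \<longleftrightarrow> \<Phi> (of_ext (D \<xi>)) = 0"
      using sq[of "of_ext (D \<xi>)"] by (auto simp: \<alpha>DX lins)
    have "(\<forall>p q. ?M p q = 0) \<longleftrightarrow>
      (\<forall>x y. alpha0 x = 0 \<longrightarrow> alpha0 y = 0 \<longrightarrow> ?M (h x) (h y) = 0) \<and>
      (\<forall>x. alpha0 x = 0 \<longrightarrow> ?M (h x) Z = 0 \<and> ?M (h x) W = 0) \<and> of_ext (D \<xi>) = 0"
      using M_gens M_Xh M_ZX M_WX M_WZ X_iff by (metis neg_equal_0_iff_equal)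
    \<comment> \<open>For \<open>u = 0\<close> conditions 2 and 4 hold, and condition 5 reduces to
      \<open>\<Phi> (of_ext (D \<xi>)) = 0\<close>.\<close>
    moreover have "br u = (\<lambda>x. - Phi0 (br u (Phi0 x)))"
      by (simp add: True fun_eq_iff lins)
    moreover have "u \<in> Rad \<theta> \<and> xi0 \<in> Rad \<theta>"
      by (simp add: True Rad_def th lins)
    moreover have "of_ext (of_g u) = 0"
      by (simp add: True of_ext_def of_g_def zero_prod_def)
    ultimately show ?thesis
      unfolding key \<theta>_iff D_iff X_iff K_def
      using bilinear_rzero[OF bE] by (metis (no_types, lifting) scaleR_zero_right add_0)
  qed
qed

end
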